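(* Let $(F_i)_{i\ge1}$ be the Fibonacci sequence and let $S:=\sum_{i=1}^{\infty}\frac{1}{F_i}$. Every $x\in(0,S)$ has a continuum of Fibonacci expansions $$x=\sum_{i=1}^{\infty}\frac{c_i}{F_i},\quad (c_i)\in\{0,1\}^{\mathbb N}.$$
   Context: The Fibonacci sequence is defined by $F_1:=1$, $F_2:=1$ and $F_{i+2}:=F_{i+1}+F_i$ for $i=1,2,\ldots$. The series $\sum_{i=1}^\infty 1/F_i$ converges (its sum is approximately $3.360$). "A continuum of expansions" means that the set of sequences $(c_i)_{i\ge1}\in\{0,1\}^{\mathbb N}$ with $x=\sum_{i=1}^\infty c_i/F_i$ has the cardinality of the continuum. *)

theory Defs
  imports "HOL-Analysis.Analysis" "HOL-Number_Theory.Fib"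
begin

text \<open>Sequences indexed by \<open>i \<ge> 1\<close> are shifted to start at \<open>0\<close>: \<open>c i\<close> is the digit with index \<open>i + 1\<close>,
  and it goes with \<open>fib (Suc i)\<close>. With \<open>fib 0 = 0\<close> and \<open>fib 1 = fib 2 = 1\<close>, the term \<open>fib 0\<close> is
  thus never used.\<close>

definition fib_expansions :: "real \<Rightarrow> (nat \<Rightarrow> nat) set" where
  "fib_expansions x =
     {c. (\<forall>i. c i \<in> {0, 1}) \<and> (\<lambda>i. real (c i) / real (fib (Suc i))) sums x}"

definition fib_recip_sum :: real where
  "fib_recip_sum = (\<Sum>i. 1 / real (fib (Suc i)))"

lemma fib_Suc_lower_bound: "2 / 3 * (3 / 2) ^ n \<le> real (fib (Suc n))"
  by (induction n rule: fib.induct) auto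

text \<open>Convergence, so that \<open>fib_recip_sum\<close> is a genuine sum.\<close>

lemma summable_fib_recip: "summable (\<lambda>i. 1 / real (fib (Suc i)))"
proof (rule summable_comparison_test')
  show "summable (\<lambda>i. 3 / 2 * (2 / 3 :: real) ^ i)"
    by (intro summable_mult summable_geometric) auto
  fix n :: nat
  have "1 / real (fib (Suc n)) \<le> 1 / (2 / 3 * (3 / 2) ^ n)"
    by (rule divide_left_mono[OF fib_Suc_lower_bound]) (auto simp: fib_neq_0_nat)
  also have "\<dots> = 3 / 2 * (2 / 3) ^ n"
    by (simp add: power_divide)
  finally show "norm (1 / real (fib (Suc n))) \<le> 3 / 2 * (2 / 3) ^ n"
    by simp
qed

end

theory Submission
  imports Defs
begin

text \<open>
  An expansion of \<open>x\<close> is built digit by digit. After the digits with index below \<open>n\<close>, a remainder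
  \<open>y\<close> has to be expanded with the terms \<open>a n, a (n + 1), \<dots>\<close> only. This succeeds in the limit as
  long as \<open>0 < y < tail n\<close>, where \<open>tail n\<close> is the sum of those terms. Both digits keep the remainder
  in the corresponding open interval exactly when \<open>a n < y < tail (n + 1)\<close>; such a level is called
  branching. If the construction meets infinitely many branching levels whatever was chosen before,
  then the free choices made there embed the set of all bit sequences into the set of expansions.

  Suppose that from some level on no level is branching, so that each digit is forced. The
  forced digits are not eventually constant, since otherwise either \<open>y\<close> or the complementary
  \<open>tail n - y\<close> would be a positive constant below tails that tend to \<open>0\<close>. So a digit \<open>0\<close> at some
  \<open>n\<close> is followed by a digit \<open>1\<close>. Being forced, these two digits give \<open>tail (n + 2) \<le> y \<le> a n\<close>.
  If the digit at \<open>n + 2\<close> is \<open>0\<close>, the pattern \<open>1, 0\<close> in the same way gives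
  \<open>tail (n + 3) \<le> a (n + 1)\<close>; if it is \<open>1\<close>, then \<open>a (n + 1) + tail (n + 3) \<le> a n\<close>.

  For the reciprocals of the Fibonacci numbers these inequalities conflict, but only just:
  replacing \<open>fib n\<close> by a multiple of the power \<open>\<phi> ^ n\<close> of the golden ratio turns
  \<open>tail (n + 2) \<le> a n\<close> into an equality. Cassini's identity decides the matter: it yields
  \<open>1 / fib m < 1 / fib (m + 2) + 1 / fib (m + 3) + \<dots>\<close> for all odd \<open>m\<close>. Writing \<open>a n = 1 / fib m\<close> with
  \<open>m = n + 1\<close>, the inequality \<open>tail (n + 2) \<le> a n\<close> therefore forces \<open>m\<close> to be even. Then \<open>m + 1\<close> is
  odd, so that \<open>a (n + 1) < tail (n + 3)\<close>, which excludes the pattern \<open>0, 1, 0\<close>. Together with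
  \<open>fib (m + 1) \<le> 2 * fib m\<close> it also gives \<open>a n \<le> 2 * a (n + 1) < a (n + 1) + tail (n + 3)\<close>, which
  excludes the pattern \<open>0, 1, 1\<close>.
\<close>

section \<open>Series in which forced digits run into a contradiction\<close>

definition series_tail :: "(nat \<Rightarrow> real) \<Rightarrow> nat \<Rightarrow> real" where
  "series_tail a n = (\<Sum>i. a (i + n))"

lemma series_tail_Suc:
  assumes "summable a"
  shows "series_tail a n = a n + series_tail a (Suc n)"
  using suminf_split_head[OF summable_ignore_initial_segment[OF assms, of n]]
  by (simp add: series_tail_def)

lemma series_tail_tendsto_0:
  assumes "summable a"
  shows "series_tail a \<longlonglongrightarrow> 0"
proof -
  have "series_tail a = (\<lambda>n. suminf a - (\<Sum>i<n. a i))"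
    using suminf_minus_initial_segment[OF assms] by (simp add: series_tail_def fun_eq_iff)
  moreover have "(\<lambda>n. suminf a - (\<Sum>i<n. a i)) \<longlonglongrightarrow> suminf a - suminf a"
    by (intro tendsto_intros summable_LIMSEQ assms)
  ultimately show ?thesis
    by simp
qed

text \<open>The last assumption excludes the inequalities that a forced digit pattern \<open>0, 1, 0\<close> or
  \<open>0, 1, 1\<close> at the levels \<open>n, n + 1, n + 2\<close> would imply. It contains Kakeya's condition
  \<open>a n < tail (n + 1)\<close>, by which the digit \<open>0\<close> is possible whenever the digit \<open>1\<close> is not.\<close>

locale branching_series =
  fixes a :: "nat \<Rightarrow> real"
  assumes pos: "a n > 0"
    and summable: "summable a"
    and no_forced_pattern: "a n < series_tail a (n + 2) \<or>
      (a (n + 1) < series_tail a (n + 3) \<and> a n < a (n + 1) + series_tail a (n + 3))"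
begin

abbreviation tail :: "nat \<Rightarrow> real" where
  "tail \<equiv> series_tail a"

lemmas tail_Suc = series_tail_Suc[OF summable]

lemma Kakeya: "a n < tail (Suc n)"
  using no_forced_pattern[of n] tail_Suc[of "n + 1"] tail_Suc[of "n + 2"] pos[of "n + 1"]
    pos[of "n + 2"]
  by (auto simp: numeral_3_eq_3)

lemma tail_le_frequently:
  assumes "0 < \<delta>"
  shows "\<exists>n\<ge>M. tail n \<le> \<delta>"
proof -
  have "\<forall>\<^sub>F n in sequentially. tail n < \<delta>"
    using series_tail_tendsto_0[OF summable] assms by (rule order_tendstoD)
  then obtain K where "\<forall>n\<ge>K. tail n < \<delta>"
    by (auto simp: eventually_sequentially)
  then show ?thesis
    by (intro exI[of _ "max K M"]) (auto intro: less_imp_le)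
qed

definition branching :: "nat \<Rightarrow> real \<Rightarrow> bool" where
  "branching n y \<longleftrightarrow> a n < y \<and> y < tail (Suc n)"

text \<open>Greedy remainders follow the forced digits as long as there is no branching level, hence
  the argument about forced digits applies to them.\<close>

lemma greedy_reaches_branching:
  assumes greedy: "\<And>n. n \<ge> N \<Longrightarrow> y (Suc n) = y n - (if a n < y n then a n else 0)"
    and range: "\<And>n. n \<ge> N \<Longrightarrow> 0 < y n \<and> y n < tail n"
  shows "\<exists>n\<ge>N. branching n (y n)"
proof (rule ccontr)
  assume "\<not> ?thesis"
  then have forced: "tail (Suc n) \<le> y n" if "n \<ge> N" "a n < y n" for n
    using that by (force simp: branching_def)
  have ex_1: "\<exists>n\<ge>M. a n < y n" if "M \<ge> N" for M
  proof (rule ccontr)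
    assume none: "\<not> ?thesis"
    have const: "y n = y M" if "n \<ge> M" for n
      using that
    proof (induction n rule: dec_induct)
      case (step n)
      then show ?case using greedy[of n] none \<open>M \<ge> N\<close> by auto
    qed simp
    have "y M < tail n" if "n \<ge> M" for n
      using range[of n] const[OF that] that \<open>M \<ge> N\<close> by simp
    moreover have "0 < y M"
      using range \<open>M \<ge> N\<close> by blast
    ultimately show False
      using tail_le_frequently[of "y M" M] by (meson not_less)
  qed
  \<comment> \<open>Mirror image: if all digits were \<open>1\<close>, then \<open>tail n - y n\<close> would be constant.\<close>
  have ex_0: "\<exists>n\<ge>M. y n \<le> a n" if "M \<ge> N" for M
  proof (rule ccontr)
    assume none: "\<not> ?thesis"
    have const: "tail n - y n = tail M - y M" if "n \<ge> M" for n
      using that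
    proof (induction n rule: dec_induct)
      case (step n)
      then show ?case using greedy[of n] none tail_Suc[of n] \<open>M \<ge> N\<close> by force
    qed simp
    have "tail M - y M < tail n" if "n \<ge> M" for n
      using range[of n] const[OF that] that \<open>M \<ge> N\<close> by simp
    moreover have "0 < tail M - y M"
      using range \<open>M \<ge> N\<close> by auto
    ultimately show False
      using tail_le_frequently[of "tail M - y M" M] by (meson not_less)
  qed
  have "\<exists>k\<ge>N. y k \<le> a k \<and> a (Suc k) < y (Suc k)"
  proof (rule ccontr)
    assume no_01: "\<not> ?thesis"
    obtain k where k: "k \<ge> N" "y k \<le> a k"
      using ex_0 by blast
    have "y n \<le> a n" if "n \<ge> k" for n
      using that
    proof (induction n rule: dec_induct)
      case (step n)
      then have "n \<ge> N"
        using k(1) by simp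
      then show ?case using no_01 step.IH by (auto simp: not_less)
    qed (fact k)
    moreover obtain n where "n \<ge> k" "a n < y n"
      using ex_1[OF k(1)] by blast
    ultimately show False
      by fastforce
  qed
  then obtain k where k: "k \<ge> N" "y k \<le> a k" "a (Suc k) < y (Suc k)"
    by blast
  \<comment> \<open>The digits at \<open>k\<close> and \<open>k + 1\<close> are \<open>0\<close> and \<open>1\<close>; the case distinction below is on the digit
    at \<open>k + 2\<close>.\<close>
  have y1: "y (Suc k) = y k"
    using greedy[OF k(1)] k(2) by simp
  have y2: "y (Suc (Suc k)) = y k - a (Suc k)"
    using greedy[of "Suc k"] k y1 by simp
  have T2: "tail (Suc (Suc k)) \<le> y k"
    using forced[of "Suc k"] k y1 by simp
  show False
  proof (cases "a (Suc (Suc k)) < y (Suc (Suc k))")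
    case True
    then have "tail (Suc (Suc (Suc k))) \<le> y k - a (Suc k)"
      using forced[of "Suc (Suc k)"] k(1) y2 by simp
    then show False
      using no_forced_pattern[of k] T2 k(2) by (simp add: numeral_3_eq_3)
  next
    case False
    then have "tail (Suc (Suc (Suc k))) \<le> a (Suc k)"
      using T2 y2 tail_Suc[of "Suc (Suc k)"] by simp
    then show False
      using no_forced_pattern[of k] T2 k(2) by (simp add: numeral_3_eq_3)
  qed
qed

section \<open>Embedding the bit sequences into the expansions\<close>

definition digit :: "(nat \<Rightarrow> bool) \<Rightarrow> nat \<Rightarrow> real \<times> nat \<Rightarrow> bool" where
  "digit b n s = (if branching n (fst s) then b (snd s) else a n < fst s)"

text \<open>The second component counts the branching levels passed so far. Consuming the bits of
  \<open>b\<close> in this order, rather than reading \<open>b n\<close> at level \<open>n\<close>, makes every bit matter.\<close>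

primrec state :: "(nat \<Rightarrow> bool) \<Rightarrow> real \<Rightarrow> nat \<Rightarrow> real \<times> nat" where
  "state b x 0 = (x, 0)"
| "state b x (Suc n) =
    (fst (state b x n) - (if digit b n (state b x n) then a n else 0),
     snd (state b x n) + (if branching n (fst (state b x n)) then 1 else 0))"

definition guided_digits :: "(nat \<Rightarrow> bool) \<Rightarrow> real \<Rightarrow> nat \<Rightarrow> nat" where
  "guided_digits b x n = of_bool (digit b n (state b x n))"

lemma remainder_range:
  assumes "0 < x" "x < tail 0"
  shows "0 < fst (state b x n) \<and> fst (state b x n) < tail n"
proof (induction n)
  case 0
  then show ?case using assms by simp
next
  case (Suc n)
  then show ?case
    using Kakeya[of n] tail_Suc[of n] by (auto simp: digit_def branching_def)
qed

lemma guided_digits_sums: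
  assumes "0 < x" "x < tail 0"
  shows "(\<lambda>n. real (guided_digits b x n) * a n) sums x"
proof -
  have partial: "(\<Sum>i<n. real (guided_digits b x i) * a i) = x - fst (state b x n)" for n
    by (induction n) (auto simp: guided_digits_def)
  have "(\<lambda>n. fst (state b x n)) \<longlonglongrightarrow> 0"
    using remainder_range[OF assms]
    by (intro tendsto_sandwich[OF _ _ tendsto_const series_tail_tendsto_0[OF summable]])
      (auto intro!: always_eventually less_imp_le)
  then have "(\<lambda>n. x - fst (state b x n)) \<longlonglongrightarrow> x - 0"
    by (intro tendsto_intros)
  then show ?thesis
    by (simp add: sums_def partial)
qed

lemma every_bit_is_used:
  assumes "0 < x" "x < tail 0"
  shows "\<exists>n. snd (state b x n) = j \<and> branching n (fst (state b x n))"
proof -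
  have next_branching: "\<exists>n\<ge>N. snd (state b x n) = snd (state b x N) \<and> branching n (fst (state b x n))"
    for N
  proof -
    have "\<exists>n\<ge>N. branching n (fst (state b x n))"
    proof (rule ccontr)
      assume none: "\<not> ?thesis"
      then have "\<exists>n\<ge>N. branching n (fst (state b x n))"
        using remainder_range[OF assms]
        by (intro greedy_reaches_branching) (auto simp: digit_def)
      with none show False ..
    qed
    then obtain n where n: "n \<ge> N" "branching n (fst (state b x n))"
      and first: "\<And>m. m < n \<Longrightarrow> \<not> (m \<ge> N \<and> branching m (fst (state b x m)))"
      unfolding exists_least_iff[of "\<lambda>n. n \<ge> N \<and> branching n (fst (state b x n))"] by blast
    have "snd (state b x m) = snd (state b x N)" if "m \<ge> N" "m \<le> n" for m
      using that
    proof (induction m rule: dec_induct)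
      case (step m)
      then show ?case using first[of m] by simp
    qed simp
    then show ?thesis
      using n by blast
  qed
  show ?thesis
  proof (induction j)
    case 0
    then show ?case using next_branching[of 0] by auto
  next
    case (Suc j)
    then obtain n where "snd (state b x n) = j" "branching n (fst (state b x n))"
      by blast
    then have "snd (state b x (Suc n)) = Suc j"
      by simp
    then show ?case using next_branching[of "Suc n"] by auto
  qed
qed

text \<open>The digits alone determine all remainders and counters, hence also at which level each
  bit was consumed; there the digit is the bit.\<close>

lemma inj_guided_digits:
  assumes "0 < x" "x < tail 0"
  shows "inj (\<lambda>b. guided_digits b x)"
proof (rule injI, rule ext)
  fix b b' j
  assume eq: "guided_digits b x = guided_digits b' x"
  have digits: "digit b n (state b x n) = digit b' n (state b' x n)" for n
    using fun_cong[OF eq, of n] by (simp add: guided_digits_def of_bool_eq_iff)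
  have same: "state b x n = state b' x n" for n
  proof (induction n)
    case (Suc n)
    then show ?case using digits[of n] by simp
  qed simp
  obtain n where "snd (state b x n) = j" "branching n (fst (state b x n))"
    using every_bit_is_used[OF assms] by blast
  with digits[of n] same[of n] show "b j = b' j"
    by (simp add: digit_def)
qed

end

lemma bit_sequences_eqpoll_reals: "(UNIV :: (nat \<Rightarrow> bool) set) \<approx> (UNIV :: real set)"
proof -
  have "bij (Collect :: (nat \<Rightarrow> bool) \<Rightarrow> nat set)"
    by (rule o_bij[of "\<lambda>A x. x \<in> A"]) (simp_all add: fun_eq_iff)
  then have "(UNIV :: (nat \<Rightarrow> bool) set) \<approx> (UNIV :: nat set set)"
    unfolding eqpoll_def by blast
  then show ?thesis
    using nat_sets_eqpoll_reals by (rule eqpoll_trans)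
qed

theorem (in branching_series) expansions_eqpoll_reals:
  assumes "0 < x" "x < tail 0"
  shows "{c :: nat \<Rightarrow> nat. (\<forall>n. c n \<in> {0, 1}) \<and> (\<lambda>n. real (c n) * a n) sums x} \<approx> (UNIV :: real set)"
    (is "?E \<approx> _")
proof (rule lepoll_antisym)
  have "inj_on (\<lambda>c n. c n = 1) ?E"
  proof (rule inj_onI, rule ext)
    fix c c' :: "nat \<Rightarrow> nat" and n
    assume "c \<in> ?E" "c' \<in> ?E" and eq: "(\<lambda>n. c n = 1) = (\<lambda>n. c' n = 1)"
    then have "c n \<in> {0, 1}" "c' n \<in> {0, 1}"
      by blast+
    with fun_cong[OF eq, of n] show "c n = c' n"
      by auto
  qed
  then have "?E \<lesssim> (UNIV :: (nat \<Rightarrow> bool) set)"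
    unfolding lepoll_def by blast
  then show "?E \<lesssim> (UNIV :: real set)"
    using bit_sequences_eqpoll_reals by (rule lepoll_trans2)
  have "range (\<lambda>b. guided_digits b x) \<subseteq> ?E"
    using guided_digits_sums[OF assms] by (auto simp: guided_digits_def)
  then have "(UNIV :: (nat \<Rightarrow> bool) set) \<lesssim> ?E"
    using inj_guided_digits[OF assms] unfolding lepoll_def by blast
  then show "(UNIV :: real set) \<lesssim> ?E"
    using bit_sequences_eqpoll_reals by (meson eqpoll_sym lepoll_trans1)
qed

section \<open>Reciprocals of the Fibonacci numbers\<close>

definition fib_recip :: "nat \<Rightarrow> real" where
  "fib_recip n = 1 / real (fib (Suc n))"

lemma fib_recip_pos: "fib_recip n > 0"
  by (simp add: fib_recip_def fib_neq_0_nat)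

lemma summable_fib_recip': "summable fib_recip"
  using summable_fib_recip by (simp add: fib_recip_def[abs_def])

lemma fib_Cassini_odd:
  "fib (2 * k + 2) ^ 2 + 1 = fib (2 * k + 1) ^ 2 + fib (2 * k + 1) * fib (2 * k + 2)"
  by (induction k) (auto simp: power2_eq_square algebra_simps)

text \<open>With \<open>p\<close> and \<open>q\<close> the Fibonacci numbers with index \<open>n + 1\<close> and \<open>n + 2\<close>, the claim amounts
  to \<open>q\<^sup>2 < p\<^sup>2 + p q\<close>, which is where the parity of \<open>n\<close> enters.\<close>

lemma fib_recip_step:
  assumes "even n"
  shows "fib_recip n - fib_recip (n + 2) < fib_recip (n + 2) + fib_recip (n + 3)"
proof -
  obtain k where n: "n = 2 * k"
    using assms by blast
  define p q where "p = real (fib (Suc n))" and "q = real (fib (Suc (Suc n)))"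
  have pq: "p > 0" "q > 0"
    by (simp_all add: p_def q_def fib_neq_0_nat del: fib.simps)
  have "q ^ 2 + 1 = p ^ 2 + p * q"
    using arg_cong[OF fib_Cassini_odd[of k], of real] by (simp add: p_def q_def n del: fib.simps)
  then have *: "q * (p + 2 * q) < p * (2 * p + 3 * q)"
    by (simp add: algebra_simps power2_eq_square)
  have recips: "fib_recip n = 1 / p" "fib_recip (n + 2) = 1 / (p + q)"
    "fib_recip (n + 3) = 1 / (p + 2 * q)"
    by (simp_all add: fib_recip_def p_def q_def numeral_3_eq_3)
  have "1 / p - 1 / (p + q) = q * (p + 2 * q) / (p * (p + q) * (p + 2 * q))"
    using pq by (simp add: divide_simps)
  also have "\<dots> < p * (2 * p + 3 * q) / (p * (p + q) * (p + 2 * q))"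
    using * pq by (intro divide_strict_right_mono) auto
  also have "\<dots> = 1 / (p + q) + 1 / (p + 2 * q)"
    using pq by (simp add: divide_simps)
  finally show ?thesis
    unfolding recips .
qed

text \<open>Both sides vanish as \<open>n\<close> grows, and by the previous lemma the difference of the two sides
  strictly decreases when \<open>n\<close> grows by \<open>2\<close>, so that it must be positive.\<close>

lemma fib_recip_less_tail_even:
  assumes "even n"
  shows "fib_recip n < series_tail fib_recip (n + 2)"
proof -
  define D where "D j = series_tail fib_recip (n + 2 * j + 2) - fib_recip (n + 2 * j)" for j
  have D_Suc: "D (Suc j) < D j" for j
    using fib_recip_step[of "n + 2 * j"] assms series_tail_Suc[OF summable_fib_recip', of "n + 2 * j + 2"]
      series_tail_Suc[OF summable_fib_recip', of "n + 2 * j + 3"]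
    by (simp add: D_def numeral_3_eq_3)
  have "(\<lambda>j. series_tail fib_recip (n + 2 * j + 2)) \<longlonglongrightarrow> 0" "(\<lambda>j. fib_recip (n + 2 * j)) \<longlonglongrightarrow> 0"
    using LIMSEQ_subseq_LIMSEQ[OF series_tail_tendsto_0[OF summable_fib_recip'], of "\<lambda>j. n + 2 * j + 2"]
      LIMSEQ_subseq_LIMSEQ[OF summable_LIMSEQ_zero[OF summable_fib_recip'], of "\<lambda>j. n + 2 * j"]
    by (simp_all add: strict_mono_def o_def)
  then have "D \<longlonglongrightarrow> 0 - 0"
    unfolding D_def by (intro tendsto_diff)
  \<comment> \<open>The limit only bounds the values of \<open>D\<close> weakly, hence one more step from \<open>1\<close> to \<open>0\<close>.\<close>
  then have "D 1 \<ge> 0"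
    using D_Suc by (intro decseq_ge) (auto intro!: decseq_SucI less_imp_le)
  with D_Suc[of 0] show ?thesis
    by (simp add: D_def)
qed

interpretation fib_recip: branching_series fib_recip
proof (unfold_locales)
  show "fib_recip n > 0" for n
    by (rule fib_recip_pos)
  show "summable fib_recip"
    by (rule summable_fib_recip')
  fix n
  show "fib_recip n < series_tail fib_recip (n + 2) \<or>
    (fib_recip (n + 1) < series_tail fib_recip (n + 3) \<and> fib_recip n < fib_recip (n + 1) + series_tail fib_recip (n + 3))"
  proof (cases "even n")
    case True
    then show ?thesis using fib_recip_less_tail_even by blast
  next
    case False
    then have next_less: "fib_recip (n + 1) < series_tail fib_recip (n + 3)"
      using fib_recip_less_tail_even[of "n + 1"] by (simp add: numeral_3_eq_3)
    have "fib (Suc (Suc n)) \<le> 2 * fib (Suc n)"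
      using fib_Suc_mono[of n] by simp
    then have "real (fib (Suc (Suc n))) \<le> 2 * real (fib (Suc n))"
      by linarith
    then have "fib_recip n \<le> 2 * fib_recip (n + 1)"
      by (simp add: fib_recip_def fib_neq_0_nat field_simps del: fib.simps)
    with next_less show ?thesis by simp
  qed
qed

theorem theorem1p5:
  fixes x :: real
  assumes "x \<in> {0<..<fib_recip_sum}"
  shows "fib_expansions x \<approx> (UNIV :: real set)"
proof -
  have "series_tail fib_recip 0 = fib_recip_sum"
    by (simp add: series_tail_def fib_recip_def fib_recip_sum_def)
  moreover have "fib_expansions x =
      {c. (\<forall>n. c n \<in> {0, 1}) \<and> (\<lambda>n. real (c n) * fib_recip n) sums x}"
    by (simp add: fib_expansions_def fib_recip_def)
  ultimately show ?thesis
    using fib_recip.expansions_eqpoll_reals[of x] assms by simp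
qed

end
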